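(* There exists an irreducible geodesic net in the Euclidean plane $\mathbb{R}^2$ that has exactly $16$ balanced vertices and exactly $4$ unbalanced vertices.
   Context: A geodesic net in the Euclidean plane is a finite connected graph embedded in $\mathbb{R}^2$ whose vertex set is partitioned into a set of prescribed "unbalanced" (boundary) vertices and a set of "balanced" vertices, such that: (i) each edge is a nondegenerate straight line segment joining two distinct vertices, and two different edges intersect, if at all, only at common endpoints (in particular edges do not overlap and every edge has multiplicity one), and no edge passes through a vertex in its interior; (ii) at each balanced vertex $v$ the sum, over all edges incident to $v$, of the unit vectors pointing from $v$ towards the other endpoint of the edge is the zero vector; (iii) conventions: every balanced vertex has degree at least $3$, and no edge joins two unbalanced vertices. No balancing condition is imposed at unbalanced vertices. Let $G$ be a geodesic net with edge set $E$. A proper geodesic subnet of $G$ is given by a subset $E_1\subset E$ with $E_1\neq\emptyset$ and $E_1\neq E$, whose vertices are the endpoints of edges in $E_1$, with balanced (respectively unbalanced) vertices being those that are balanced (respectively unbalanced) vertices of $G$, such that at every balanced vertex $v$ of $G$ that is an endpoint of some edge in $E_1$ the sum of the unit vectors at $v$ along the edges of $E_1$ incident to $v$ is zero. (In a subnet, balanced vertices of degree $2$, i.e. points in the interior of a straight segment, are allowed, since such vertices can be added or removed at will.) A geodesic net is irreducible if it has no proper geodesic subnet. *)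

theory Defs
  imports "HOL-Analysis.Analysis"
begin

type_synonym plane = "real ^ 2"

text \<open>
  An edge is the set of its two endpoints, and the segment that realizes it is the convex hull
  of this set. Hence a set of edges carries no multiplicities.
\<close>

definition incident_edges :: "plane set set \<Rightarrow> plane \<Rightarrow> plane set set" where
  "incident_edges E v = {e \<in> E. v \<in> e}"

definition graph_connected :: "plane set \<Rightarrow> plane set set \<Rightarrow> bool" where
  "graph_connected V E \<longleftrightarrow>
     V \<noteq> {} \<and> (\<forall>x\<in>V. \<forall>y\<in>V. (x, y) \<in> {(u, w). {u, w} \<in> E}\<^sup>*)"

definition embedded_graph :: "plane set \<Rightarrow> plane set set \<Rightarrow> bool" where
  "embedded_graph V E \<longleftrightarrow>
     finite V \<and>
     (\<forall>e\<in>E. \<exists>v\<in>V. \<exists>w\<in>V. v \<noteq> w \<and> e = {v, w}) \<and>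
     (\<forall>e\<in>E. \<forall>f\<in>E. e \<noteq> f \<longrightarrow> convex hull e \<inter> convex hull f \<subseteq> e \<inter> f) \<and>
     (\<forall>e\<in>E. V \<inter> convex hull e \<subseteq> e)"

text \<open>
  For \<open>w \<noteq> v\<close>, \<^term>\<open>sgn (w - v)\<close> is the unit vector pointing from \<open>v\<close> to \<open>w\<close>. The edges
  at \<open>v\<close> correspond bijectively to their other endpoints \<open>w\<close>.
\<close>

definition balanced_at :: "plane set set \<Rightarrow> plane \<Rightarrow> bool" where
  "balanced_at E v \<longleftrightarrow> (\<Sum>w | {v, w} \<in> E. sgn (w - v)) = 0"

text \<open>\<open>U\<close> is the set of unbalanced vertices and \<open>B\<close> the set of balanced vertices.\<close>

definition geodesic_net :: "plane set \<Rightarrow> plane set \<Rightarrow> plane set set \<Rightarrow> bool" where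
  "geodesic_net U B E \<longleftrightarrow>
     U \<inter> B = {} \<and>
     embedded_graph (U \<union> B) E \<and>
     graph_connected (U \<union> B) E \<and>
     (\<forall>v\<in>B. balanced_at E v) \<and>
     (\<forall>v\<in>B. card (incident_edges E v) \<ge> 3) \<and>
     (\<forall>e\<in>E. \<not> e \<subseteq> U)"

text \<open>A subnet need not be connected, and its balanced vertices may have degree 2.\<close>

definition proper_subnet :: "plane set \<Rightarrow> plane set set \<Rightarrow> plane set set \<Rightarrow> bool" where
  "proper_subnet B E E1 \<longleftrightarrow>
     E1 \<subseteq> E \<and> E1 \<noteq> {} \<and> E1 \<noteq> E \<and> (\<forall>v \<in> B \<inter> \<Union>E1. balanced_at E1 v)"

definition irreducible_net :: "plane set \<Rightarrow> plane set \<Rightarrow> plane set set \<Rightarrow> bool" where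
  "irreducible_net U B E \<longleftrightarrow> geodesic_net U B E \<and> (\<nexists>E1. proper_subnet B E E1)"

end

theory Submission
  imports Defs
begin

text \<open>
  The net is invariant under the symmetry group of a square whose corners are the unbalanced vertices.
  Modulo this group it has four balanced vertices: a vertex D of degree 5 on the diagonal, vertices A
  and F of degree 3 on the axis, and between them a triple crossing C, where the straight lines from
  D to a neighbouring corner, and their mirror images, meet the axis. Every edge lies in a closed
  fundamental sector, and folding the plane onto this sector reduces embeddedness to the seven edges
  in it.

  At D, A and F there is a linear functional that is positive on exactly one of the edge directions,
  so a balanced subset of the edges at such a vertex is empty or full. At C only opposite edges can
  balance each other. These local rules link all edges, which gives irreducibility.
\<close>

section \<open>Coordinates in the plane\<close>

definition pt :: "real \<Rightarrow> real \<Rightarrow> plane" where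
  "pt x y = vector [x, y]"

lemma pt_nth [simp]: "pt x y $ 1 = x" "pt x y $ 2 = y"
  by (simp_all add: pt_def)

lemma plane_eq_iff: "(z::plane) = w \<longleftrightarrow> z $ 1 = w $ 1 \<and> z $ 2 = w $ 2"
  by (simp add: vec_eq_iff forall_2)

lemma pt_eq_iff [simp]: "pt x y = pt x' y' \<longleftrightarrow> x = x' \<and> y = y'"
  by (simp add: plane_eq_iff)

lemma norm_plane: "norm (z::plane) = sqrt ((z $ 1)\<^sup>2 + (z $ 2)\<^sup>2)"
  by (simp add: norm_vec_def L2_set_def sum_2)

lemma sgn_plane_nth:
  "sgn (z::plane) $ i = z $ i / sqrt ((z $ 1)\<^sup>2 + (z $ 2)\<^sup>2)"
  by (simp add: sgn_div_norm norm_plane divide_inverse mult.commute)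

section \<open>The symmetry group of the square\<close>

text \<open>These are the eight signed permutation matrices, the dihedral group of the square with
  corners (\<plusminus>1, \<plusminus>1).\<close>

definition act :: "bool \<Rightarrow> real \<Rightarrow> real \<Rightarrow> plane \<Rightarrow> plane" where
  "act s i j z = (if s then pt (i * z $ 2) (j * z $ 1) else pt (i * z $ 1) (j * z $ 2))"

definition square_group :: "(plane \<Rightarrow> plane) set" where
  "square_group = {act s i j | s i j. i \<in> {1, -1} \<and> j \<in> {1, -1}}"

text \<open>\<open>flip\<close> and \<open>swap\<close> are the reflections in the two walls of the
  sector \<open>0 \<le> y \<le> x\<close>. The copies adjacent to the copy \<open>g\<close> come
  from composing on the right: \<open>g \<circ> flip\<close> and
  \<open>g \<circ> swap\<close>.\<close>

definition flip :: "plane \<Rightarrow> plane" where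
  "flip z = pt (z $ 1) (- z $ 2)"

definition swap :: "plane \<Rightarrow> plane" where
  "swap z = pt (z $ 2) (z $ 1)"

lemma flip_pt [simp]: "flip (pt x y) = pt x (- y)"
  by (simp add: flip_def)

lemma swap_pt [simp]: "swap (pt x y) = pt y x"
  by (simp add: swap_def)

lemma square_groupE:
  assumes "g \<in> square_group"
  obtains s i j where "g = act s i j" "i = 1 \<or> i = -1" "j = 1 \<or> j = -1"
  using assms unfolding square_group_def by auto

lemma act_pt [simp]:
  "act s i j (pt x y) = (if s then pt (i * y) (j * x) else pt (i * x) (j * y))"
  by (simp add: act_def)

lemma act_in_square_group: "i \<in> {1, -1} \<Longrightarrow> j \<in> {1, -1} \<Longrightarrow> act s i j \<in> square_group"
  unfolding square_group_def by blast

lemma act_flip: "act s i j \<circ> flip = (if s then act s (- i) j else act s i (- j))"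
  by (auto simp: fun_eq_iff act_def flip_def)

lemma act_swap: "act s i j \<circ> swap = act (\<not> s) i j"
  by (auto simp: fun_eq_iff act_def swap_def)

lemma id_in_square_group: "id \<in> square_group"
proof -
  have "id = act False 1 1"
    by (auto simp: fun_eq_iff act_def plane_eq_iff)
  then show ?thesis
    using act_in_square_group[of 1 1 False] by simp
qed

lemma comp_flip_in_square_group: "g \<in> square_group \<Longrightarrow> g \<circ> flip \<in> square_group"
  by (erule square_groupE) (auto simp: act_flip intro!: act_in_square_group)

lemma comp_swap_in_square_group: "g \<in> square_group \<Longrightarrow> g \<circ> swap \<in> square_group"
  by (erule square_groupE) (auto simp: act_swap intro!: act_in_square_group)

text \<open>The two wall reflections generate the group. The rule carries a property from one copy
  of the sector to its neighbours; connectedness and irreducibility both spread over the net in this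
  way.\<close>

lemma square_group_induct [consumes 1, case_names id flip swap]:
  assumes g: "g \<in> square_group" and id: "Q id"
    and flip: "\<And>g. g \<in> square_group \<Longrightarrow> Q g \<Longrightarrow> Q (g \<circ> flip)"
    and swap: "\<And>g. g \<in> square_group \<Longrightarrow> Q g \<Longrightarrow> Q (g \<circ> swap)"
  shows "Q g"
proof -
  have f: "Q (act s i j) \<Longrightarrow> Q (if s then act s (- i) j else act s i (- j))"
    and s: "Q (act s i j) \<Longrightarrow> Q (act (\<not> s) i j)"
    if "i \<in> {1, -1}" "j \<in> {1, -1}" for s i j
    using flip[of "act s i j"] swap[of "act s i j"] act_in_square_group[OF that]
    by (simp_all add: act_flip act_swap)
  have "act False 1 1 = id"
    by (auto simp: fun_eq_iff act_def plane_eq_iff)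
  then have 1: "Q (act False 1 1)" using id by simp
  \<comment> \<open>Each new element arises from an earlier one by a single wall reflection, until
    all eight are reached.\<close>
  have 2: "Q (act True 1 1)" using s[of 1 1 False] 1 by simp
  have 3: "Q (act False 1 (-1))" using f[of 1 1 False] 1 by simp
  have 4: "Q (act True 1 (-1))" using s[of 1 "-1" False] 3 by simp
  have 5: "Q (act True (-1) 1)" using f[of 1 1 True] 2 by simp
  have 6: "Q (act False (-1) 1)" using s[of "-1" 1 True] 5 by simp
  have 7: "Q (act False (-1) (-1))" using f[of "-1" 1 False] 6 by simp
  have 8: "Q (act True (-1) (-1))" using s[of "-1" "-1" False] 7 by simp
  show ?thesis
    using g 1 2 3 4 5 6 7 8 by (elim square_groupE) (metis (full_types))
qed

lemma finite_square_group: "finite square_group"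
proof -
  have "square_group \<subseteq> (\<lambda>(s, i, j). act s i j) ` (UNIV \<times> {1, -1} \<times> {1, -1})"
    unfolding square_group_def by force
  then show ?thesis
    by (rule finite_subset) simp
qed

lemma linear_square_group: "g \<in> square_group \<Longrightarrow> linear g"
  by (erule square_groupE, rule linearI) (auto simp: act_def plane_eq_iff algebra_simps)

lemma norm_square_group: "g \<in> square_group \<Longrightarrow> norm (g z) = norm z"
  by (erule square_groupE) (auto simp: act_def norm_plane add.commute)

lemma sgn_square_group:
  assumes "g \<in> square_group"
  shows "sgn (g w - g v) = g (sgn (w - v))"
proof -
  have l: "linear g" using assms by (rule linear_square_group)
  show ?thesis
    by (simp add: sgn_div_norm norm_square_group[OF assms] linear_scale[OF l]
        flip: linear_diff[OF l])
qed

lemma square_group_eq_iff: "g \<in> square_group \<Longrightarrow> g z = g w \<longleftrightarrow> z = w"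
  using norm_square_group[of g "z - w"] linear_diff[OF linear_square_group, of g z w] by auto

lemma square_group_zero_iff: "g \<in> square_group \<Longrightarrow> g z = 0 \<longleftrightarrow> z = 0"
  using norm_square_group[of g z] by (metis norm_eq_zero)

section \<open>Folding the plane onto the fundamental sector\<close>

definition fold_sector :: "plane \<Rightarrow> plane" where
  "fold_sector z = pt (max \<bar>z $ 1\<bar> \<bar>z $ 2\<bar>) (min \<bar>z $ 1\<bar> \<bar>z $ 2\<bar>)"

definition sector :: "plane set" where
  "sector = {z. 0 \<le> z $ 2 \<and> z $ 2 \<le> z $ 1}"

lemma convex_sector: "convex sector"
  unfolding convex_def sector_def by (auto intro!: add_mono mult_left_mono)

text \<open>A group element changes only the signs and the order of the coordinates, and folding
  forgets exactly these. Hence an orbit meets the sector in at most one point.\<close>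

lemma fold_sector_square_group: "g \<in> square_group \<Longrightarrow> z \<in> sector \<Longrightarrow> fold_sector (g z) = z"
  by (erule square_groupE)
    (auto simp: act_def fold_sector_def sector_def plane_eq_iff max_def min_def)

lemma square_group_same_image:
  assumes "g \<in> square_group" "h \<in> square_group" "z \<in> sector" "w \<in> sector" "g z = h w"
  shows "z = w"
  using assms fold_sector_square_group by metis

text \<open>Inside the sector only the identity fixes a point, and on one wall only the reflection
  in it is added. The condition \<open>0 < z $ 1\<close> excludes the origin, which the whole group
  fixes.\<close>

lemma square_group_stabilizer:
  assumes "g \<in> square_group" "h \<in> square_group" and z: "z \<in> sector" "0 < z $ 1"
    and eq: "g z = h z"
  shows "h = g \<or> z $ 2 = 0 \<and> h = g \<circ> flip \<or> z $ 1 = z $ 2 \<and> h = g \<circ> swap"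
proof -
  from assms obtain s i j s' i' j'
    where g: "g = act s i j" "i = 1 \<or> i = -1" "j = 1 \<or> j = -1"
      and h: "h = act s' i' j'" "i' = 1 \<or> i' = -1" "j' = 1 \<or> j' = -1"
    by (metis square_groupE)
  show ?thesis
    using g(2,3) h(2,3) eq z unfolding g(1) h(1) act_flip act_swap
    by (cases s; cases s') (auto simp: act_def sector_def)
qed

section \<open>The net in the fundamental sector\<close>

text \<open>
  Straightness at C determines \<open>c0\<close> from \<open>t0\<close>, and the 120 degree angles at A and F determine
  \<open>a0\<close> and \<open>f0\<close>. Balance at D then becomes \<open>t0 / sqrt (1 + t0\<^sup>2) = 1 / 2 - sin 15\<degree>\<close>.
  The order of the points on the axis amounts to \<open>t0 < tan 15\<degree> = 2 - sqrt 3\<close>.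
\<close>

definition sin15 :: real where
  "sin15 = (sqrt 6 - sqrt 2) / 4"

definition t0 :: real where
  "t0 = (1 / 2 - sin15) / sqrt (1 - (1 / 2 - sin15)\<^sup>2)"

definition a0 :: real where "a0 = t0 + t0 / sqrt 3"
definition c0 :: real where "c0 = 2 * t0 / (1 + t0)"
definition f0 :: real where "f0 = 1 - 1 / sqrt 3"

section \<open>Numerical estimates and the order of the points on the axis\<close>

lemma sin15_bounds: "0.258 < sin15" "sin15 < 0.26"
proof -
  have "2.449 < sqrt 6" "1.414 < sqrt 2"
    by (rule real_less_rsqrt, simp add: power2_eq_square)+
  moreover have "sqrt 6 < 2.45" "sqrt 2 < 1.415"
    by (rule real_less_lsqrt; simp add: power2_eq_square)+
  ultimately show "0.258 < sin15" "sin15 < 0.26"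
    unfolding sin15_def by auto
qed

text \<open>With \<open>t0\<close> = tan \<theta> the left side is sin \<theta>. The edges from D to
  C and to A deviate by \<theta> and by 15 degrees from the perpendicular to the diagonal, so
  balance along the diagonal at D reads 2 sin \<theta> + 2 sin 15 = 1.\<close>

lemma t0_eq: "t0 / sqrt (1 + t0\<^sup>2) = 1 / 2 - sin15"
proof -
  define s where "s = 1 / 2 - sin15"
  have s: "0 < s" "s < 1" using sin15_bounds by (auto simp: s_def)
  then have s2: "s\<^sup>2 < 1" by (simp add: power_less_one_iff)
  have t: "t0 = s / sqrt (1 - s\<^sup>2)" by (simp add: t0_def s_def)
  have "1 + t0\<^sup>2 = 1 / (1 - s\<^sup>2)"
    using s2 by (simp add: t power_divide divide_simps)
  then have "sqrt (1 + t0\<^sup>2) = 1 / sqrt (1 - s\<^sup>2)"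
    by (simp add: real_sqrt_divide)
  then have "t0 / sqrt (1 + t0\<^sup>2) = s"
    using s2 by (simp add: t)
  then show ?thesis by (simp add: s_def)
qed

lemma t0_pos: "0 < t0"
proof -
  have "(1 / 2 - sin15)\<^sup>2 < 1"
    using sin15_bounds by (intro power_less_one_iff[THEN iffD2]) auto
  then show ?thesis
    using sin15_bounds by (simp add: t0_def)
qed

lemma t0_less: "t0 < 2 - sqrt 3"
proof -
  have t: "t0 = (1 / 2 - sin15) * sqrt (1 + t0\<^sup>2)"
    using t0_eq by (simp add: field_simps add_nonneg_eq_0_iff)
  have "t0\<^sup>2 = (1 / 2 - sin15)\<^sup>2 * (1 + t0\<^sup>2)"
    by (subst t) (simp add: power_mult_distrib)
  \<comment> \<open>The constant is \<open>1 / 2 - 0.258\<close>. It gives \<open>t0 < 0.25\<close>,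
    which suffices because \<open>2 - sqrt 3\<close> exceeds 0.26.\<close>
  also have "\<dots> \<le> 0.242\<^sup>2 * (1 + t0\<^sup>2)"
    using sin15_bounds by (intro mult_right_mono power_mono) auto
  finally have "t0\<^sup>2 < 0.25\<^sup>2" by (simp add: power2_eq_square)
  then have "t0 < 0.25" by (rule power_less_imp_less_base) simp
  moreover have "sqrt 3 < 1.74"
    by (rule real_less_lsqrt) (auto simp: power2_eq_square)
  ultimately show ?thesis by simp
qed

text \<open>Clearing denominators reduces this, and likewise \<open>c0 < f0\<close>, to
  \<open>t0 < 2 - sqrt 3\<close>. At equality A, C and F would coincide.\<close>

lemma a0_less_c0: "a0 < c0"
proof -
  have "(1 + t0) * (sqrt 3 + 1) < (3 - sqrt 3) * (sqrt 3 + 1)"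
    using t0_less by (intro mult_strict_right_mono) (auto intro: add_nonneg_pos)
  also have "\<dots> = 2 * sqrt 3" by (simp add: algebra_simps)
  finally have *: "(1 + t0) * (1 + 1 / sqrt 3) < 2" by (simp add: field_simps)
  have "a0 * (1 + t0) = t0 * ((1 + t0) * (1 + 1 / sqrt 3))"
    by (simp add: a0_def algebra_simps)
  also have "\<dots> < t0 * 2"
    using * t0_pos by (rule mult_strict_left_mono)
  finally show ?thesis
    using t0_pos by (simp add: c0_def pos_less_divide_eq)
qed

lemma c0_less_f0: "c0 < f0"
proof -
  have "t0 * (sqrt 3 + 1) < (2 - sqrt 3) * (sqrt 3 + 1)"
    using t0_less by (intro mult_strict_right_mono) (auto intro: add_nonneg_pos)
  also have "\<dots> = sqrt 3 - 1" by (simp add: algebra_simps)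
  finally have "2 * t0 < (1 - 1 / sqrt 3) * (1 + t0)" by (simp add: field_simps)
  then show ?thesis
    using t0_pos by (simp add: c0_def f0_def pos_divide_less_eq)
qed

lemma coords_order: "0 < t0" "t0 < a0" "a0 < c0" "c0 < f0" "f0 < 1"
  using t0_pos a0_less_c0 c0_less_f0 by (auto simp: a0_def f0_def)

section \<open>The points and edges in the sector and how the edges meet\<close>

definition pU :: plane where "pU = pt 1 1"
definition pD :: plane where "pD = pt t0 t0"
definition pA :: plane where "pA = pt a0 0"
definition pC :: plane where "pC = pt c0 0"
definition pF :: plane where "pF = pt f0 0"

lemmas point_defs = pU_def pD_def pA_def pC_def pF_def

definition sector_edges :: "plane set set" where
  "sector_edges = {{pU, pD}, {pU, pC}, {pU, pF}, {pC, pD}, {pA, pD}, {pA, pC}, {pC, pF}}"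

lemma sector_points: "pU \<in> sector" "pD \<in> sector" "pA \<in> sector" "pC \<in> sector" "pF \<in> sector"
  using coords_order by (simp_all add: sector_def point_defs)

lemma points_distinct [simp]:
  "pU \<noteq> pD" "pU \<noteq> pA" "pU \<noteq> pC" "pU \<noteq> pF" "pD \<noteq> pU" "pD \<noteq> pA" "pD \<noteq> pC" "pD \<noteq> pF"
  "pA \<noteq> pU" "pA \<noteq> pD" "pA \<noteq> pC" "pA \<noteq> pF" "pC \<noteq> pU" "pC \<noteq> pD" "pC \<noteq> pA" "pC \<noteq> pF"
  "pF \<noteq> pU" "pF \<noteq> pD" "pF \<noteq> pA" "pF \<noteq> pC"
  using coords_order by (simp_all add: point_defs)

lemma sector_edges_subset: "e \<in> sector_edges \<Longrightarrow> e \<subseteq> {pU, pD, pA, pC, pF}"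
  unfolding sector_edges_def by auto

lemma sector_edge_hull_subset: "e \<in> sector_edges \<Longrightarrow> convex hull e \<subseteq> sector"
  using sector_edges_subset[of e] sector_points
  by (intro hull_minimal convex_sector) auto

lemma hull_ptE:
  assumes "z \<in> convex hull {pt x y, pt x' y'}"
  obtains u where "0 \<le> u" "u \<le> 1" "z $ 1 = x + u * (x' - x)" "z $ 2 = y + u * (y' - y)"
proof -
  from assms obtain u where u: "0 \<le> u" "u \<le> 1"
    and z: "z = (1 - u) *\<^sub>R pt x y + u *\<^sub>R pt x' y'"
    by (auto simp: segment_convex_hull[symmetric] in_segment)
  show thesis
    by (rule that[OF u]) (simp_all add: z algebra_simps)
qed

lemma hull_diag:
  assumes "z \<in> convex hull {pU, pD}"
  shows "z $ 1 = z $ 2" "t0 \<le> z $ 2"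
proof -
  from assms obtain u where "0 \<le> u" "u \<le> 1" "z $ 1 = 1 + u * (t0 - 1)" "z $ 2 = 1 + u * (t0 - 1)"
    unfolding point_defs by (rule hull_ptE)
  moreover from this have "(1 - u) * (1 - t0) \<ge> 0" using coords_order by simp
  ultimately show "z $ 1 = z $ 2" "t0 \<le> z $ 2" by (auto simp: algebra_simps)
qed

lemma hull_axis:
  assumes "z \<in> convex hull {pt x 0, pt x' 0}" "x \<le> x'"
  shows "z $ 2 = 0" "x \<le> z $ 1" "z $ 1 \<le> x'"
proof -
  from assms(1) obtain u where "0 \<le> u" "u \<le> 1" "z $ 1 = x + u * (x' - x)" "z $ 2 = 0"
    by (rule hull_ptE) simp
  moreover from this have "(1 - u) * (x' - x) \<ge> 0" using assms(2) by simp
  moreover have "u * (x' - x) \<ge> 0" using calculation(1) assms(2) by simp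
  ultimately show "z $ 2 = 0" "x \<le> z $ 1" "z $ 1 \<le> x'" by (auto simp: algebra_simps)
qed

lemma hull_axis_corner:
  assumes "z \<in> convex hull {pU, pt x 0}" "x \<le> 1"
  shows "z $ 1 = x + (1 - x) * z $ 2" "x \<le> z $ 1"
proof -
  from assms(1) obtain u where u: "0 \<le> u" "u \<le> 1"
    and z: "z $ 1 = 1 + u * (x - 1)" "z $ 2 = 1 + u * (0 - 1)"
    unfolding pU_def by (rule hull_ptE)
  have "(1 - u) * (1 - x) \<ge> 0" using u assms(2) by simp
  then show "z $ 1 = x + (1 - x) * z $ 2" "x \<le> z $ 1"
    unfolding z by (simp_all add: algebra_simps)
qed

lemma hull_axis_diag:
  assumes "z \<in> convex hull {pt x 0, pD}" "t0 \<le> x"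
  shows "t0 * (x - z $ 1) = (x - t0) * z $ 2" "z $ 1 \<le> x"
proof -
  from assms(1) obtain u where u: "0 \<le> u"
    and z: "z $ 1 = x + u * (t0 - x)" "z $ 2 = 0 + u * (t0 - 0)"
    unfolding pD_def by (rule hull_ptE)
  have "u * (x - t0) \<ge> 0" using u assms(2) by simp
  then show "t0 * (x - z $ 1) = (x - t0) * z $ 2" "z $ 1 \<le> x"
    unfolding z by (simp_all add: algebra_simps)
qed

lemma diag_corner:
  assumes "z $ 1 = z $ 2" "z $ 1 = x + (1 - x) * z $ 2" "0 < x"
  shows "z = pU"
proof -
  have "x * (1 - z $ 2) = 0" using assms(1,2) by (simp add: algebra_simps)
  then show ?thesis using assms by (simp add: plane_eq_iff pU_def)
qed

lemma diag_axis:
  assumes "z $ 1 = z $ 2" "t0 * (x - z $ 1) = (x - t0) * z $ 2" "0 < x"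
  shows "z = pD"
proof -
  have "x * (t0 - z $ 2) = 0" using assms(1,2) by (simp add: algebra_simps)
  then show ?thesis using assms by (simp add: plane_eq_iff pD_def)
qed

text \<open>For each edge these are the equation of its line and the bounds that matter. The
  equations locate common points of edges on different lines; the bounds and the order of the
  coordinates separate the rest.\<close>

lemma sector_edge_hulls:
  shows hull_UD: "z \<in> convex hull {pU, pD} \<Longrightarrow> z $ 1 = z $ 2 \<and> t0 \<le> z $ 2"
    and hull_UC: "z \<in> convex hull {pU, pC} \<Longrightarrow> z $ 1 = c0 + (1 - c0) * z $ 2 \<and> c0 \<le> z $ 1"
    and hull_UF: "z \<in> convex hull {pU, pF} \<Longrightarrow> z $ 1 = f0 + (1 - f0) * z $ 2 \<and> f0 \<le> z $ 1"
    and hull_CD: "z \<in> convex hull {pC, pD} \<Longrightarrow> t0 * (c0 - z $ 1) = (c0 - t0) * z $ 2 \<and> z $ 1 \<le> c0"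
    and hull_AD: "z \<in> convex hull {pA, pD} \<Longrightarrow> t0 * (a0 - z $ 1) = (a0 - t0) * z $ 2 \<and> z $ 1 \<le> a0"
    and hull_AC: "z \<in> convex hull {pA, pC} \<Longrightarrow> z $ 2 = 0 \<and> a0 \<le> z $ 1 \<and> z $ 1 \<le> c0"
    and hull_CF: "z \<in> convex hull {pC, pF} \<Longrightarrow> z $ 2 = 0 \<and> c0 \<le> z $ 1 \<and> z $ 1 \<le> f0"
  using coords_order hull_diag[of z] hull_axis_corner[of z c0] hull_axis_corner[of z f0]
    hull_axis_diag[of z c0] hull_axis_diag[of z a0] hull_axis[of z a0 c0] hull_axis[of z c0 f0]
  by (simp_all add: pA_def pC_def pF_def)

lemma sector_edges_meet:
  assumes e: "e \<in> sector_edges" and e': "e' \<in> sector_edges" and ne: "e \<noteq> e'"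
    and z: "z \<in> convex hull e" "z \<in> convex hull e'"
  shows "z \<in> e \<and> z \<in> e'"
proof -
  note o = coords_order
  have corner: "z = pU"
    if "z $ 1 = c0 + (1 - c0) * z $ 2" "z $ 1 = f0 + (1 - f0) * z $ 2"
  proof -
    have "(f0 - c0) * (1 - z $ 2) = 0" using that by (simp add: algebra_simps)
    then show ?thesis using that o by (simp add: plane_eq_iff pU_def)
  qed
  have diag: "z = pD"
    if "t0 * (a0 - z $ 1) = (a0 - t0) * z $ 2" "t0 * (c0 - z $ 1) = (c0 - t0) * z $ 2"
  proof -
    have "(c0 - a0) * (t0 - z $ 2) = 0" using that by (simp add: algebra_simps)
    then have y: "z $ 2 = t0" using o by simp
    then have "t0 * (t0 - z $ 1) = 0" using that(1) by (simp add: algebra_simps)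
    then show ?thesis using y o by (simp add: plane_eq_iff pD_def)
  qed
  have axis: "z = pt x 0" if "z $ 1 = x" "z $ 2 = 0" for x
    using that by (simp add: plane_eq_iff)
  \<comment> \<open>Each of the 21 pairs of edges is treated in one order only; the disjunction over
    both orders below makes the relation symmetric for \<open>pairwise\<close>.\<close>
  define meet where "meet e f \<longleftrightarrow>
    (z \<in> convex hull e \<longrightarrow> z \<in> convex hull f \<longrightarrow> z \<in> e \<and> z \<in> f)" for e f
  have UC_CD: "z = pC" if "z $ 1 = c0 + (1 - c0) * z $ 2" "t0 * (c0 - z $ 1) = (c0 - t0) * z $ 2"
  proof -
    have "z $ 2 * (c0 * (1 - t0)) = 0"
      using that(2) unfolding that(1) by (simp add: algebra_simps)
    then have "z $ 2 = 0" using o by simp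
    then show ?thesis using that by (simp add: plane_eq_iff pC_def)
  qed
  have "meet {pU, pD} {pU, pC}"
    using hull_UD[of z] hull_UC[of z] diag_corner[of z c0] o by (auto simp: meet_def)
  moreover have "meet {pU, pD} {pU, pF}"
    using hull_UD[of z] hull_UF[of z] diag_corner[of z f0] o by (auto simp: meet_def)
  moreover have "meet {pU, pD} {pC, pD}"
    using hull_UD[of z] hull_CD[of z] diag_axis[of z c0] o by (auto simp: meet_def)
  moreover have "meet {pU, pD} {pA, pD}"
    using hull_UD[of z] hull_AD[of z] diag_axis[of z a0] o by (auto simp: meet_def)
  moreover have "meet {pU, pD} {pA, pC}"
    using hull_UD[of z] hull_AC[of z] o by (auto simp: meet_def)
  moreover have "meet {pU, pD} {pC, pF}"
    using hull_UD[of z] hull_CF[of z] o by (auto simp: meet_def)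
  moreover have "meet {pU, pC} {pU, pF}"
    using hull_UC[of z] hull_UF[of z] corner by (auto simp: meet_def)
  moreover have "meet {pU, pC} {pC, pD}"
    using hull_UC[of z] hull_CD[of z] UC_CD by (auto simp: meet_def)
  moreover have "meet {pU, pC} {pA, pD}"
    using hull_UC[of z] hull_AD[of z] o by (auto simp: meet_def)
  moreover have "meet {pU, pC} {pA, pC}"
    using hull_UC[of z] hull_AC[of z] axis[of c0, folded pC_def] by (auto simp: meet_def)
  moreover have "meet {pU, pC} {pC, pF}"
    using hull_UC[of z] hull_CF[of z] axis[of c0, folded pC_def] by (auto simp: meet_def)
  moreover have "meet {pU, pF} {pC, pD}"
    using hull_UF[of z] hull_CD[of z] o by (auto simp: meet_def)
  moreover have "meet {pU, pF} {pA, pD}"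
    using hull_UF[of z] hull_AD[of z] o by (auto simp: meet_def)
  moreover have "meet {pU, pF} {pA, pC}"
    using hull_UF[of z] hull_AC[of z] o by (auto simp: meet_def)
  moreover have "meet {pU, pF} {pC, pF}"
    using hull_UF[of z] hull_CF[of z] axis[of f0, folded pF_def] by (auto simp: meet_def)
  moreover have "meet {pC, pD} {pA, pD}"
    using hull_CD[of z] hull_AD[of z] diag by (auto simp: meet_def)
  moreover have "meet {pC, pD} {pA, pC}"
    using hull_CD[of z] hull_AC[of z] axis[of c0, folded pC_def] o by (auto simp: meet_def)
  moreover have "meet {pC, pD} {pC, pF}"
    using hull_CD[of z] hull_CF[of z] axis[of c0, folded pC_def] o by (auto simp: meet_def)
  moreover have "meet {pA, pD} {pA, pC}"
    using hull_AD[of z] hull_AC[of z] axis[of a0, folded pA_def] o by (auto simp: meet_def)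
  moreover have "meet {pA, pD} {pC, pF}"
    using hull_AD[of z] hull_CF[of z] o by (auto simp: meet_def)
  moreover have "meet {pA, pC} {pC, pF}"
    using hull_AC[of z] hull_CF[of z] axis[of c0, folded pC_def] by (auto simp: meet_def)
  ultimately have "pairwise (\<lambda>e f. meet e f \<or> meet f e) sector_edges"
    unfolding sector_edges_def pairwise_insert by auto
  then have "meet e e' \<or> meet e' e"
    using e e' ne unfolding pairwise_def by blast
  then show ?thesis
    using z by (auto simp: meet_def)
qed

lemma wall_points [simp]:
  "flip pA = pA" "flip pC = pC" "flip pF = pF" "swap pU = pU" "swap pD = pD"
  by (simp_all add: point_defs)

text \<open>The walls bound the sector, so an edge touches a wall only at an endpoint unless it lies
  in the wall, where the reflection fixes it pointwise. This prevents two different copies of one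
  edge from meeting at an inner point.\<close>

lemma sector_edge_wall:
  assumes e: "e \<in> sector_edges" and z: "z \<in> convex hull e"
  shows "0 < z $ 1"
    and "z $ 2 = 0 \<Longrightarrow> z \<in> e \<or> (\<forall>v\<in>e. flip v = v)"
    and "z $ 1 = z $ 2 \<Longrightarrow> z \<in> e \<or> (\<forall>v\<in>e. swap v = v)"
proof -
  note o = coords_order
  have s: "0 \<le> z $ 2" "z $ 2 \<le> z $ 1"
    using sector_edge_hull_subset[OF e] z by (auto simp: sector_def)
  show "0 < z $ 1"
  proof (rule ccontr)
    assume "\<not> 0 < z $ 1"
    then have "z $ 1 = 0" "z $ 2 = 0" using s by auto
    then show False
      using e z o unfolding sector_edges_def by (auto dest!: sector_edge_hulls)
  qed
  have axis: "z = pt x 0" if "z $ 2 = 0" "z $ 1 = x" for x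
    using that by (simp add: plane_eq_iff)
  show "z \<in> e \<or> (\<forall>v\<in>e. flip v = v)" if "z $ 2 = 0"
    using e z o that axis[of a0, folded pA_def] axis[of c0, folded pC_def] axis[of f0, folded pF_def]
    unfolding sector_edges_def by (auto dest!: sector_edge_hulls)
  show "z \<in> e \<or> (\<forall>v\<in>e. swap v = v)" if "z $ 1 = z $ 2"
  proof -
    have "z \<in> convex hull {pU, pC} \<Longrightarrow> z = pU" "z \<in> convex hull {pU, pF} \<Longrightarrow> z = pU"
      using hull_UC[of z] hull_UF[of z] diag_corner[OF that, of c0] diag_corner[OF that, of f0] o by simp_all
    moreover have "z \<in> convex hull {pC, pD} \<Longrightarrow> z = pD" "z \<in> convex hull {pA, pD} \<Longrightarrow> z = pD"
      using hull_CD[of z] hull_AD[of z] diag_axis[OF that, of c0] diag_axis[OF that, of a0] o by simp_all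
    moreover have "z \<notin> convex hull {pA, pC}" "z \<notin> convex hull {pC, pF}"
      using hull_AC[of z] hull_CF[of z] that o by auto
    ultimately show ?thesis
      using e z unfolding sector_edges_def by (elim insertE emptyE) auto
  qed
qed

section \<open>The net\<close>

definition net_edges :: "plane set set" where
  "net_edges = {g ` e | g e. g \<in> square_group \<and> e \<in> sector_edges}"

definition unbalanced :: "plane set" where
  "unbalanced = {g pU | g. g \<in> square_group}"

definition balanced :: "plane set" where
  "balanced = {g v | g v. g \<in> square_group \<and> v \<in> {pD, pA, pC, pF}}"

lemma net_edges_meet:
  assumes g: "g \<in> square_group" and h: "h \<in> square_group"
    and e: "e \<in> sector_edges" and e': "e' \<in> sector_edges" and ne: "g ` e \<noteq> h ` e'"
  shows "convex hull (g ` e) \<inter> convex hull (h ` e') \<subseteq> g ` e \<inter> h ` e'"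
proof
  fix x assume "x \<in> convex hull (g ` e) \<inter> convex hull (h ` e')"
  then have "x \<in> g ` (convex hull e)" "x \<in> h ` (convex hull e')"
    by (simp_all add: convex_hull_linear_image linear_square_group g h)
  then obtain z w where z: "z \<in> convex hull e" "x = g z" and w: "w \<in> convex hull e'" "x = h w"
    by blast
  have zs: "z \<in> sector" "w \<in> sector"
    using z w sector_edge_hull_subset e e' by auto
  \<comment> \<open>Both preimages lie in the sector and in the same orbit, so folding identifies
    them.\<close>
  with g h z w have [simp]: "w = z"
    using square_group_same_image by metis
  have "z \<in> e \<and> z \<in> e'"
  proof (cases "e = e'")
    case False
    then show ?thesis using sector_edges_meet e e' z w by auto
  next
    case [simp]: True
    have "z \<in> e"
    proof (rule ccontr)
      assume "z \<notin> e"
      \<comment> \<open>At an inner point of \<open>e\<close>, \<open>h\<close> is either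
        \<open>g\<close> or \<open>g\<close> followed on the right by a reflection that fixes
        \<open>e\<close> pointwise. The two copies of \<open>e\<close> then coincide, contrary to
        \<open>ne\<close>.\<close>
      then have "g v = h v" if "v \<in> e" for v
        using square_group_stabilizer[OF g h zs(1)] sector_edge_wall[OF e z(1)] z w that
        by fastforce
      then show False using ne by (auto intro: image_cong)
    qed
    then show ?thesis by simp
  qed
  then show "x \<in> g ` e \<inter> h ` e'"
    using imageI[of z e g] z(2) imageI[of z e' h] w(2) by simp
qed

lemma finite_net_edges: "finite net_edges"
proof -
  have "net_edges \<subseteq> (\<lambda>(g, e). g ` e) ` (square_group \<times> sector_edges)"
    unfolding net_edges_def by auto
  then show ?thesis
    by (rule finite_subset) (simp add: finite_square_group sector_edges_def)
qed

lemma net_edgesI: "g \<in> square_group \<Longrightarrow> {p, q} \<in> sector_edges \<Longrightarrow> {g p, g q} \<in> net_edges"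
  unfolding net_edges_def by (intro CollectI exI[of _ g] exI[of _ "{p, q}"]) auto

text \<open>Every edge can be oriented to start at a balanced vertex \<open>p\<close>; this also
  rules out edges between unbalanced vertices.\<close>

lemma net_edgesE:
  assumes "e \<in> net_edges"
  obtains g p q where "g \<in> square_group" "{p, q} \<in> sector_edges" "e = {g p, g q}"
    "p \<in> {pD, pA, pC, pF}" "q \<in> {pU, pD, pC, pF}" "p \<noteq> q"
proof -
  from assms obtain g e' where g: "g \<in> square_group" "e' \<in> sector_edges" "e = g ` e'"
    unfolding net_edges_def by auto
  have "\<exists>p\<in>{pD, pA, pC, pF}. \<exists>q\<in>{pU, pD, pC, pF}. e' = {p, q} \<and> p \<noteq> q"
    using g(2) unfolding sector_edges_def
    by (elim insertE emptyE) (auto simp: doubleton_eq_iff)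
  then obtain p q where "p \<in> {pD, pA, pC, pF}" "q \<in> {pU, pD, pC, pF}" "e' = {p, q}" "p \<noteq> q"
    by blast
  then show thesis using g by (intro that[of g p q]) auto
qed

lemma vertices_eq:
  "unbalanced \<union> balanced = {g v | g v. g \<in> square_group \<and> v \<in> {pU, pD, pA, pC, pF}}"
  unfolding unbalanced_def balanced_def by blast

lemma disjoint_vertices: "unbalanced \<inter> balanced = {}"
proof -
  have "g pU \<noteq> h v" if "g \<in> square_group" "h \<in> square_group" "v \<in> {pD, pA, pC, pF}" for g h v
    using square_group_same_image[OF that(1,2), of pU v] that(3) sector_points by auto
  then show ?thesis
    unfolding unbalanced_def balanced_def by blast
qed

lemma finite_vertices: "finite (unbalanced \<union> balanced)"
proof -
  have "unbalanced \<union> balanced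
      \<subseteq> (\<lambda>(g, v). g v) ` (square_group \<times> {pU, pD, pA, pC, pF})"
    unfolding vertices_eq by force
  then show ?thesis
    by (rule finite_subset) (simp add: finite_square_group)
qed

lemma net_embedded: "embedded_graph (unbalanced \<union> balanced) net_edges"
proof -
  have ends: "\<exists>v\<in>unbalanced \<union> balanced. \<exists>w\<in>unbalanced \<union> balanced. v \<noteq> w \<and> e = {v, w}"
    if e: "e \<in> net_edges" for e
  proof -
    from e obtain g p q where g: "g \<in> square_group" "e = {g p, g q}" "p \<noteq> q"
      and "p \<in> {pD, pA, pC, pF}" "q \<in> {pU, pD, pC, pF}"
      by (rule net_edgesE)
    then have "g p \<in> unbalanced \<union> balanced" "g q \<in> unbalanced \<union> balanced"
      unfolding vertices_eq by auto
    moreover have "g p \<noteq> g q" using g by (simp add: square_group_eq_iff)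
    ultimately show ?thesis using g(2) by blast
  qed
  have meet: "convex hull e \<inter> convex hull f \<subseteq> e \<inter> f"
    if "e \<in> net_edges" "f \<in> net_edges" "e \<noteq> f" for e f
    using that net_edges_meet unfolding net_edges_def by blast
  have "x \<in> e" if e: "e \<in> net_edges" and x: "x \<in> unbalanced \<union> balanced" "x \<in> convex hull e" for e x
  proof -
    from x(1) obtain g v where g: "g \<in> square_group" "v \<in> {pU, pD, pA, pC, pF}" "x = g v"
      unfolding vertices_eq by blast
    \<comment> \<open>Every vertex is an endpoint of some edge, so a vertex in the interior of
      another edge would contradict \<open>meet\<close>.\<close>
    then obtain e' where e': "e' \<in> sector_edges" "v \<in> e'"
      unfolding sector_edges_def by blast
    have f: "g ` e' \<in> net_edges" "x \<in> g ` e'"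
      using g e' unfolding net_edges_def by auto
    show ?thesis
      using meet[OF e f(1)] f(2) x(2) hull_inc[OF f(2), of convex] by blast
  qed
  then have "(unbalanced \<union> balanced) \<inter> convex hull e \<subseteq> e" if "e \<in> net_edges" for e
    using that by blast
  then show ?thesis
    using finite_vertices ends meet unfolding embedded_graph_def by (intro conjI ballI impI)
qed

section \<open>Connectedness\<close>

lemma net_connected: "graph_connected (unbalanced \<union> balanced) net_edges"
proof -
  define r where "r = {(u, w). {u, w} \<in> net_edges}"
  have "sym r" unfolding r_def sym_def by (auto simp: insert_commute)
  then have sym: "sym (r\<^sup>*)" by (rule sym_rtrancl)
  have edge: "(g p, g q) \<in> r\<^sup>*" if "g \<in> square_group" "{p, q} \<in> sector_edges" for g p q
    using net_edgesI[OF that] unfolding r_def by blast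
  \<comment> \<open>Within one copy, U is adjacent to D, C and F, and reaches A through D.\<close>
  have local: "(g pU, g v) \<in> r\<^sup>*" if g: "g \<in> square_group" and v: "v \<in> {pU, pD, pA, pC, pF}" for g v
  proof -
    have "{pU, pD} \<in> sector_edges" "{pU, pC} \<in> sector_edges" "{pU, pF} \<in> sector_edges"
      "{pD, pA} \<in> sector_edges"
      by (simp_all add: sector_edges_def insert_commute)
    note paths = this[THEN edge[OF g]]
    show ?thesis
      using v paths rtrancl_trans[OF paths(1,4)] by blast
  qed
  have root: "(pU, g pU) \<in> r\<^sup>*" if "g \<in> square_group" for g
    using that
  proof (induction rule: square_group_induct)
    case (flip g)
    \<comment> \<open>Copies adjacent across the axis share C, so the path passes through it. Across
      the diagonal they share U itself, and that case is immediate.\<close>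
    have "(g pC, (g \<circ> flip) pU) \<in> r\<^sup>*"
      using symD[OF sym local[OF comp_flip_in_square_group[OF flip(1)], of pC]] by simp
    moreover have "(g pU, g pC) \<in> r\<^sup>*"
      using local[OF flip(1), of pC] by simp
    ultimately show ?case
      using flip(2) by (meson rtrancl_trans)
  qed auto
  have "(pU, v) \<in> r\<^sup>*" if "v \<in> unbalanced \<union> balanced" for v
  proof -
    from that obtain g u
      where g: "g \<in> square_group" and u: "u \<in> {pU, pD, pA, pC, pF}" and v: "v = g u"
      unfolding vertices_eq by blast
    then show ?thesis
      using rtrancl_trans[OF root[OF g] local[OF g u]] by simp
  qed
  then have "(v, w) \<in> r\<^sup>*" if "v \<in> unbalanced \<union> balanced" "w \<in> unbalanced \<union> balanced" for v w
    using that sym by (meson rtrancl_trans symD)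
  moreover have "unbalanced \<noteq> {}"
    using id_in_square_group unfolding unbalanced_def by blast
  ultimately show ?thesis
    unfolding graph_connected_def r_def by blast
qed

text \<open>Here \<open>s\<close> is the reflection in the wall containing \<open>v\<close>. By the
  stabilizer lemma only \<open>g\<close> and \<open>g \<circ> s\<close> map \<open>v\<close> to
  \<open>g v\<close>, so every edge at \<open>g v\<close> comes from one of these two
  copies.\<close>

lemma neighbours_square_group:
  fixes v defines "s \<equiv> if v = pD then swap else flip"
  assumes g: "g \<in> square_group" and v: "v \<in> {pD, pA, pC, pF}"
  shows "{w. {g v, w} \<in> net_edges}
    = g ` ({u. {v, u} \<in> sector_edges} \<union> s ` {u. {v, u} \<in> sector_edges})" (is "?L = ?R")
proof
  have vs: "v \<in> sector" "0 < v $ 1"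
    using v sector_points coords_order by (auto simp: point_defs)
  have sv: "s v = v" and gs: "g \<circ> s \<in> square_group"
    using v g comp_swap_in_square_group comp_flip_in_square_group by (auto simp: s_def)
  have stab: "h = g \<or> h = g \<circ> s" if "h \<in> square_group" "g v = h v" for h
    using square_group_stabilizer[OF g that(1) vs that(2)] v coords_order
    by (auto simp: s_def point_defs)
  show "?L \<subseteq> ?R"
  proof
    fix w assume "w \<in> ?L"
    then have "{g v, w} \<in> net_edges" by simp
    then obtain h p q where h: "h \<in> square_group" "{p, q} \<in> sector_edges" "{g v, w} = {h p, h q}"
      by (rule net_edgesE)
    have pq: "p \<in> sector" "q \<in> sector"
      using sector_edges_subset[OF h(2)] sector_points by auto
    from h(3) have "g v = h p \<and> w = h q \<or> g v = h q \<and> w = h p"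
      by (auto simp: doubleton_eq_iff)
    then obtain x where x: "{v, x} \<in> sector_edges" "g v = h v" "w = h x"
    proof (elim disjE conjE)
      assume "g v = h p" "w = h q"
      moreover from this have "v = p"
        using square_group_same_image[OF g h(1) vs(1) pq(1)] by simp
      ultimately show thesis using h(2) that by blast
    next
      assume "g v = h q" "w = h p"
      moreover from this have "v = q"
        using square_group_same_image[OF g h(1) vs(1) pq(2)] by simp
      ultimately show thesis using h(2) that[of p] by (simp add: insert_commute)
    qed
    from stab[OF h(1) x(2)] show "w \<in> ?R"
    proof
      assume "h = g"
      then show ?thesis using x by blast
    next
      assume "h = g \<circ> s"
      then have "w = g (s x)" using x(3) by simp
      then show ?thesis using x(1) by blast
    qed
  qed
  show "?R \<subseteq> ?L"
  proof
    fix w assume "w \<in> ?R"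
    then obtain u where u: "{v, u} \<in> sector_edges" "w = g u \<or> w = g (s u)"
      by blast
    have "{g v, g u} \<in> net_edges" "{(g \<circ> s) v, (g \<circ> s) u} \<in> net_edges"
      using u(1) g gs by (auto simp only: net_edgesI)
    with u(2) show "w \<in> ?L"
      unfolding comp_apply sv by blast
  qed
qed

section \<open>Vertex orbits and their sizes\<close>

lemma orbit_diag:
  "{g (pt x x) | g. g \<in> square_group} = {pt x x, pt x (-x), pt (-x) x, pt (-x) (-x)}" (is "?L = ?R")
proof
  show "?L \<subseteq> ?R"
    by (auto elim!: square_groupE)
  have "act False i j (pt x x) \<in> ?L" if "i \<in> {1, -1}" "j \<in> {1, -1}" for i j
    using act_in_square_group[OF that, of False] by blast
  from this[of 1 1] this[of 1 "-1"] this[of "-1" 1] this[of "-1" "-1"]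
  show "?R \<subseteq> ?L" by simp
qed

lemma orbit_axis:
  "{g (pt x 0) | g. g \<in> square_group} = {pt x 0, pt 0 x, pt (-x) 0, pt 0 (-x)}" (is "?L = ?R")
proof
  show "?L \<subseteq> ?R"
    by (auto elim!: square_groupE split: if_splits)
  have "act s i i (pt x 0) \<in> ?L" if "i \<in> {1, -1}" for s i
    using act_in_square_group[OF that that, of s] by blast
  from this[of 1 False] this[of 1 True] this[of "-1" False] this[of "-1" True]
  show "?R \<subseteq> ?L" by simp
qed

lemma card_unbalanced: "card unbalanced = 4"
  unfolding unbalanced_def pU_def orbit_diag by simp

text \<open>Each of D, A, C and F lies on exactly one wall, so its stabilizer has order 2 in a group
  of order 8. This gives four disjoint orbits of four points.\<close>

lemma card_balanced: "card balanced = 16"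
proof -
  have "balanced = {g pD | g. g \<in> square_group} \<union> {g pA | g. g \<in> square_group}
      \<union> {g pC | g. g \<in> square_group} \<union> {g pF | g. g \<in> square_group}"
    unfolding balanced_def by blast
  also have "card \<dots> = 16"
    unfolding point_defs orbit_diag orbit_axis using coords_order by simp
  finally show ?thesis .
qed

section \<open>The force balance\<close>

definition nbrs :: "plane \<Rightarrow> plane set" where
  "nbrs v = {u. {v, u} \<in> net_edges}"

lemma nbrs_eq:
  "nbrs pD = {pU, pC, swap pC, pA, swap pA}"
  "nbrs pA = {pC, pD, flip pD}"
  "nbrs pC = {pA, pF, pU, flip pU, pD, flip pD}"
  "nbrs pF = {pC, pU, flip pU}"
proof -
  have "{u. {pD, u} \<in> sector_edges} = {pU, pC, pA}" "{u. {pA, u} \<in> sector_edges} = {pC, pD}"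
    "{u. {pC, u} \<in> sector_edges} = {pU, pD, pA, pF}" "{u. {pF, u} \<in> sector_edges} = {pU, pC}"
    unfolding sector_edges_def by (auto simp: doubleton_eq_iff)
  then show
    "nbrs pD = {pU, pC, swap pC, pA, swap pA}"
    "nbrs pA = {pC, pD, flip pD}"
    "nbrs pC = {pA, pF, pU, flip pU, pD, flip pD}"
    "nbrs pF = {pC, pU, flip pU}"
    using neighbours_square_group[OF id_in_square_group] unfolding nbrs_def by auto
qed

lemma finite_nbrs: "v \<in> {pD, pA, pC, pF} \<Longrightarrow> finite (nbrs v)"
  by (auto simp: nbrs_eq)

lemma neighbours_image:
  assumes "g \<in> square_group" "v \<in> {pD, pA, pC, pF}"
  shows "{w. {g v, w} \<in> net_edges} = g ` nbrs v"
  using neighbours_square_group[OF assms] neighbours_square_group[OF id_in_square_group assms(2)]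
  unfolding nbrs_def by simp

text \<open>A linear isometry carries the unit vectors at \<open>v\<close> to those at
  \<open>g v\<close>, so every balance condition can be tested in the sector. The form with a subset
  \<open>E1\<close> serves both the net and its candidate subnets.\<close>

lemma balanced_at_iff:
  assumes g: "g \<in> square_group" and v: "v \<in> {pD, pA, pC, pF}" and E1: "E1 \<subseteq> net_edges"
  shows "balanced_at E1 (g v) \<longleftrightarrow> (\<Sum>u | u \<in> nbrs v \<and> {g v, g u} \<in> E1. sgn (u - v)) = 0"
proof -
  let ?N = "{u \<in> nbrs v. {g v, g u} \<in> E1}"
  have inj: "inj_on g A" for A
    using square_group_eq_iff[OF g] by (auto simp: inj_on_def)
  have "{w. {g v, w} \<in> E1} = {w \<in> g ` nbrs v. {g v, w} \<in> E1}"
    unfolding neighbours_image[OF g v, symmetric] using E1 by auto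
  also have "\<dots> = g ` ?N" by auto
  finally have "(\<Sum>w | {g v, w} \<in> E1. sgn (w - g v)) = (\<Sum>u\<in>?N. sgn (g u - g v))"
    using inj by (simp add: sum.reindex)
  also have "\<dots> = g (\<Sum>u\<in>?N. sgn (u - v))"
    by (simp add: sgn_square_group[OF g] linear_sum[OF linear_square_group[OF g]])
  finally show ?thesis
    unfolding balanced_at_def using square_group_zero_iff[OF g] by simp
qed

text \<open>\<open>(dx, - dy)\<close> is the unit vector from D towards the corner (1, -1), and the
  root is their distance. C is the point where this line crosses the axis.\<close>

definition dx :: real where "dx = (1 - t0) / sqrt (2 + 2 * t0\<^sup>2)"
definition dy :: real where "dy = (1 + t0) / sqrt (2 + 2 * t0\<^sup>2)"

text \<open>The value \<open>1 / 2\<close> for \<open>dx\<close> would allow balanced triples with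
  120 degree angles at C. It would force \<open>t0 = 2 - sqrt 3\<close>, which the strict bound on
  \<open>t0\<close> excludes.\<close>

lemma dx_dy: "dx\<^sup>2 + dy\<^sup>2 = 1" "0 < dx" "dx < dy" "dx \<noteq> 1 / 2"
proof -
  have p: "0 < 2 + 2 * t0\<^sup>2" by (simp add: add_pos_nonneg)
  then show "dx\<^sup>2 + dy\<^sup>2 = 1"
    by (simp add: dx_def dy_def power_divide add_divide_distrib[symmetric])
      (simp add: power2_eq_square algebra_simps)
  show "0 < dx" "dx < dy"
    using p coords_order by (auto simp: dx_def dy_def divide_strict_right_mono)
  show "dx \<noteq> 1 / 2"
  proof
    assume "dx = 1 / 2"
    then have "(1 / 2)\<^sup>2 = (1 - t0)\<^sup>2 / (2 + 2 * t0\<^sup>2)"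
      using p by (metis dx_def power_divide real_sqrt_pow2 less_imp_le)
    then have "(2 - t0)\<^sup>2 = (sqrt 3)\<^sup>2"
      using p by (simp add: field_simps power2_eq_square)
    moreover have "sqrt 3 < 2 - t0" using t0_less by simp
    ultimately show False
      using power_strict_mono[of "sqrt 3" "2 - t0" 2] by simp
  qed
qed

text \<open>This is the force balance at D in coordinates; by symmetry in the diagonal both
  coordinates give the same equation. The left side is \<open>sqrt 2\<close> times the sine
  evaluated in \<open>t0_eq\<close>.\<close>

lemma dx_dy_diff: "dy - dx = sqrt 2 / 2 - (sqrt 3 - 1) / 2"
proof -
  have "dy - dx = 2 * t0 / (sqrt 2 * sqrt (1 + t0\<^sup>2))"
    unfolding dx_def dy_def by (simp add: diff_divide_distrib[symmetric] real_sqrt_mult[symmetric] algebra_simps)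
  also have "\<dots> = (2 / sqrt 2) * (t0 / sqrt (1 + t0\<^sup>2))"
    by simp
  also have "\<dots> = sqrt 2 * (t0 / sqrt (1 + t0\<^sup>2))"
    by (simp only: real_div_sqrt zero_le_numeral)
  also have "\<dots> = sqrt 2 * (1 / 2 - (sqrt 6 - sqrt 2) / 4)"
    by (simp add: t0_eq sin15_def)
  also have "sqrt 6 = sqrt 2 * sqrt 3"
    by (simp add: real_sqrt_mult[symmetric])
  finally have "dy - dx = (2 * sqrt 2 - (sqrt 2 * sqrt 2) * sqrt 3 + sqrt 2 * sqrt 2) / 4"
    by (simp only: right_diff_distrib times_divide_eq_right) (simp add: field_simps)
  then show ?thesis by (simp add: field_simps)
qed

lemma sgn_pt_eq:
  assumes "0 < k" "x\<^sup>2 + y\<^sup>2 = 1"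
  shows "sgn (pt (k * x) (k * y)) = pt x y"
proof -
  have "(k * x)\<^sup>2 + (k * y)\<^sup>2 = k\<^sup>2 * (x\<^sup>2 + y\<^sup>2)"
    by (simp add: algebra_simps)
  then have "(k * x)\<^sup>2 + (k * y)\<^sup>2 = k\<^sup>2" using assms(2) by simp
  then show ?thesis
    using assms(1) by (simp add: plane_eq_iff sgn_plane_nth)
qed

lemma pt_diff: "pt x y - pt x' y' = pt (x - x') (y - y')"
  by (simp add: plane_eq_iff)

lemma directions:
  "sgn (pU - pD) = pt (sqrt 2 / 2) (sqrt 2 / 2)"
  "sgn (pC - pD) = pt dx (- dy)" "sgn (swap pC - pD) = pt (- dy) dx"
  "sgn (pA - pD) = pt (1 / 2) (- sqrt 3 / 2)" "sgn (swap pA - pD) = pt (- sqrt 3 / 2) (1 / 2)"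
  "sgn (pC - pA) = pt 1 0"
  "sgn (pD - pA) = pt (- 1 / 2) (sqrt 3 / 2)" "sgn (flip pD - pA) = pt (- 1 / 2) (- sqrt 3 / 2)"
  "sgn (pA - pC) = pt (- 1) 0" "sgn (pF - pC) = pt 1 0"
  "sgn (pU - pC) = pt dx dy" "sgn (flip pU - pC) = pt dx (- dy)"
  "sgn (pD - pC) = pt (- dx) dy" "sgn (flip pD - pC) = pt (- dx) (- dy)"
  "sgn (pC - pF) = pt (- 1) 0"
  "sgn (pU - pF) = pt (1 / 2) (sqrt 3 / 2)" "sgn (flip pU - pF) = pt (1 / 2) (- sqrt 3 / 2)"
proof -
  note o = coords_order
  define m where "m = sqrt (2 + 2 * t0\<^sup>2)"
  have m: "0 < m" unfolding m_def by (simp add: add_pos_nonneg)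
  have scale: "sgn (pt a b) = pt x y" if "a = k * x" "b = k * y" "0 < k" "x\<^sup>2 + y\<^sup>2 = 1" for a b k x y
    using sgn_pt_eq[OF that(3,4)] that(1,2) by simp
  have h: "(sqrt 2 / 2)\<^sup>2 + (sqrt 2 / 2)\<^sup>2 = (1::real)" "(1 / 2)\<^sup>2 + (sqrt 3 / 2)\<^sup>2 = (1::real)"
    by (simp_all add: power_divide)
  have d: "dx * m = 1 - t0" "dy * m = 1 + t0"
    using m by (simp_all add: dx_def dy_def m_def)
  have t: "1 + t0 \<noteq> 0" using o by simp
  \<comment> \<open>These are \<open>1 - t0\<close> scaled by \<open>t0 / (1 + t0)\<close> and
    \<open>1 / (1 + t0)\<close>; the same factors take \<open>1 + t0\<close> to the height
    differences \<open>t0\<close> and 1. This is straightness at C.\<close>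
  then have c: "c0 - t0 = t0 * (1 - t0) / (1 + t0)" "1 - c0 = (1 - t0) / (1 + t0)"
    by (simp_all add: c0_def field_simps)
  \<comment> \<open>\<open>k\<close>, \<open>l\<close>, \<open>n\<close> and \<open>q\<close> are
    the lengths of the edges CD, CU, AD and FU.\<close>
  define k where "k = t0 * m / (1 + t0)"
  have k: "0 < k" using o m by (simp add: k_def)
  have "k * dx = t0 * (dx * m) / (1 + t0)" "k * dy = t0 * (dy * m) / (1 + t0)"
    by (simp_all add: k_def)
  then have kd: "k * dx = c0 - t0" "k * dy = t0"
    using t by (simp_all add: c d)
  define l where "l = m / (1 + t0)"
  have l: "0 < l" using o m by (simp add: l_def)
  have "l * dx = (dx * m) / (1 + t0)" "l * dy = (dy * m) / (1 + t0)"
    by (simp_all add: l_def)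
  then have ld: "l * dx = 1 - c0" "l * dy = 1"
    using t by (simp_all add: c d)
  define n where "n = 2 * t0 / sqrt 3"
  have n: "0 < n" "n * (1 / 2) = a0 - t0" "n * (sqrt 3 / 2) = t0"
    using o by (simp_all add: n_def a0_def)
  define q where "q = 2 / sqrt 3"
  have q: "0 < q" "q * (1 / 2) = 1 - f0" "q * (sqrt 3 / 2) = 1"
    by (simp_all add: q_def f0_def)
  have unit: "dx\<^sup>2 + dy\<^sup>2 = 1" "dy\<^sup>2 + dx\<^sup>2 = 1"
    using dx_dy(1) by simp_all
  show "sgn (pU - pD) = pt (sqrt 2 / 2) (sqrt 2 / 2)"
    using o scale[of "1 - t0" "(1 - t0) * sqrt 2" "sqrt 2 / 2" "1 - t0" "sqrt 2 / 2"] h(1)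
    by (simp add: point_defs pt_diff mult.assoc)
  show "sgn (pC - pD) = pt dx (- dy)"
    using scale[of "c0 - t0" k dx "- t0" "- dy"] k kd unit by (simp add: point_defs pt_diff)
  show "sgn (swap pC - pD) = pt (- dy) dx"
    using scale[of "- t0" k "- dy" "c0 - t0" dx] k kd unit by (simp add: point_defs pt_diff)
  show "sgn (pD - pC) = pt (- dx) dy"
    using scale[of "t0 - c0" k "- dx" t0 dy] k kd unit by (simp add: point_defs pt_diff)
  show "sgn (flip pD - pC) = pt (- dx) (- dy)"
    using scale[of "t0 - c0" k "- dx" "- t0" "- dy"] k kd unit by (simp add: point_defs pt_diff)
  show "sgn (pU - pC) = pt dx dy"
    using scale[of "1 - c0" l dx 1 dy] l ld unit by (simp add: point_defs pt_diff)
  show "sgn (flip pU - pC) = pt dx (- dy)"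
    using scale[of "1 - c0" l dx "- 1" "- dy"] l ld unit by (simp add: point_defs pt_diff)
  show "sgn (pA - pD) = pt (1 / 2) (- sqrt 3 / 2)"
    using scale[of "a0 - t0" n "1 / 2" "- t0" "- sqrt 3 / 2"] n h(2) by (simp add: point_defs pt_diff)
  show "sgn (swap pA - pD) = pt (- sqrt 3 / 2) (1 / 2)"
    using scale[of "- t0" n "- sqrt 3 / 2" "a0 - t0" "1 / 2"] n h(2)
    by (simp add: point_defs pt_diff add.commute)
  show "sgn (pD - pA) = pt (- 1 / 2) (sqrt 3 / 2)"
    using scale[of "t0 - a0" n "- 1 / 2" t0 "sqrt 3 / 2"] n h(2) by (simp add: point_defs pt_diff)
  show "sgn (flip pD - pA) = pt (- 1 / 2) (- sqrt 3 / 2)"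
    using scale[of "t0 - a0" n "- 1 / 2" "- t0" "- sqrt 3 / 2"] n h(2) by (simp add: point_defs pt_diff)
  show "sgn (pU - pF) = pt (1 / 2) (sqrt 3 / 2)"
    using scale[of "1 - f0" q "1 / 2" 1 "sqrt 3 / 2"] q h(2) by (simp add: point_defs pt_diff)
  show "sgn (flip pU - pF) = pt (1 / 2) (- sqrt 3 / 2)"
    using scale[of "1 - f0" q "1 / 2" "- 1" "- sqrt 3 / 2"] q h(2) by (simp add: point_defs pt_diff)
  show "sgn (pC - pA) = pt 1 0" "sgn (pF - pC) = pt 1 0"
    using o scale[of "c0 - a0" "c0 - a0" 1 0 0] scale[of "f0 - c0" "f0 - c0" 1 0 0]
    by (simp_all add: point_defs pt_diff)
  show "sgn (pA - pC) = pt (- 1) 0" "sgn (pC - pF) = pt (- 1) 0"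
    using o scale[of "a0 - c0" "c0 - a0" "- 1" 0 0] scale[of "c0 - f0" "f0 - c0" "- 1" 0 0]
    by (simp_all add: point_defs pt_diff)
qed

lemma neighbour_points_distinct:
  "pU \<notin> {pC, swap pC, pA, swap pA}" "pC \<notin> {swap pC, pA, swap pA}" "swap pC \<notin> {pA, swap pA}"
  "pA \<noteq> swap pA" "pC \<notin> {pD, flip pD}" "pD \<noteq> flip pD"
  "pA \<notin> {pF, pU, flip pU, pD, flip pD}" "pF \<notin> {pU, flip pU, pD, flip pD}"
  "pU \<notin> {flip pU, pD, flip pD}" "flip pU \<notin> {pD, flip pD}" "pC \<notin> {pU, flip pU}"
  using coords_order by (simp_all add: point_defs)

lemma sum_neighbours:
  assumes "v \<in> {pD, pA, pC, pF}"
  shows "(\<Sum>u\<in>nbrs v. sgn (u - v)) = 0"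
proof -
  have add: "pt x y + pt x' y' = pt (x + x') (y + y')" for x y x' y'
    by (simp add: plane_eq_iff)
  have zero: "pt x y = 0 \<longleftrightarrow> x = 0 \<and> y = 0" for x y
    by (simp add: plane_eq_iff)
  note simps = nbrs_eq directions add zero
  have "(\<Sum>u\<in>nbrs pD. sgn (u - pD)) = 0"
    using neighbour_points_distinct dx_dy_diff by (simp add: simps field_simps)
  moreover have "(\<Sum>u\<in>nbrs pA. sgn (u - pA)) = 0"
    using neighbour_points_distinct by (simp add: simps)
  moreover have "(\<Sum>u\<in>nbrs pC. sgn (u - pC)) = 0"
    using neighbour_points_distinct by (simp add: simps)
  moreover have "(\<Sum>u\<in>nbrs pF. sgn (u - pF)) = 0"
    using neighbour_points_distinct by (simp add: simps)
  ultimately show ?thesis using assms by auto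
qed

lemma card_nbrs:
  assumes "v \<in> {pD, pA, pC, pF}"
  shows "3 \<le> card (nbrs v)"
proof -
  have "card (nbrs pD) = 5" "card (nbrs pA) = 3" "card (nbrs pC) = 6" "card (nbrs pF) = 3"
    using neighbour_points_distinct by (simp_all add: nbrs_eq)
  then show ?thesis using assms by auto
qed

section \<open>Selection rules for balanced subsets of the edges at a vertex\<close>

lemma single_positive_all_or_none:
  fixes f :: "'a \<Rightarrow> real"
  assumes S: "finite S" "p \<in> S" and neg: "\<And>u. u \<in> S \<Longrightarrow> u \<noteq> p \<Longrightarrow> f u < 0"
    and full: "sum f S = 0" and part: "sum f {u \<in> S. R u} = 0" and u: "u \<in> S"
  shows "R u \<longleftrightarrow> R p"
\<comment> \<open>Of the selected and unselected parts of \<open>S\<close>, the one without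
  \<open>p\<close> sums to zero and has only negative terms, so it is empty.\<close>
proof (cases "R p")
  case True
  have "sum f {u \<in> S. \<not> R u} = sum f S - sum f {u \<in> S. R u}"
    using S(1) by (simp add: sum_diff[symmetric] set_diff_eq) (metis (lifting) mem_Collect_eq Collect_cong)
  then have "sum (\<lambda>u. - f u) {u \<in> S. \<not> R u} = 0"
    using full part by (simp add: sum_negf)
  moreover have "0 \<le> - f w" if "w \<in> {u \<in> S. \<not> R u}" for w
    using neg[of w] that True by force
  ultimately have "\<forall>w\<in>{u \<in> S. \<not> R u}. - f w = 0"
    using S(1) by (subst (asm) sum_nonneg_eq_0_iff) auto
  then show ?thesis
    using neg[of u] u True by force
next
  case False
  have "0 \<le> - f w" if "w \<in> {u \<in> S. R u}" for w
    using neg[of w] that False by force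
  moreover have "sum (\<lambda>u. - f u) {u \<in> S. R u} = 0"
    using part by (simp add: sum_negf)
  ultimately have "\<forall>w\<in>{u \<in> S. R u}. - f w = 0"
    using S(1) by (subst (asm) sum_nonneg_eq_0_iff) auto
  then show ?thesis
    using neg[of u] u False by force
qed

lemma nbrs_all_or_none:
  assumes v: "v \<in> {pD, pA, pF}" and R: "(\<Sum>u | u \<in> nbrs v \<and> R u. sgn (u - v)) = 0"
    and u: "u \<in> nbrs v" "w \<in> nbrs v"
  shows "R u \<longleftrightarrow> R w"
proof -
  have v': "v \<in> {pD, pA, pC, pF}" using v by auto
  \<comment> \<open>At D the functional is taken along the diagonal and is positive only towards U.
    At A and F it points along the axis towards C and is positive only on that edge.\<close>
  define f where "f z = (if v = pD then z $ 1 + z $ 2 else if v = pA then z $ 1 else - z $ 1)"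
    for z :: plane
  have "linear f"
    by (rule linearI) (auto simp: f_def algebra_simps)
  then have fsum: "f (sum h A) = (\<Sum>u\<in>A. f (h u))" for h :: "plane \<Rightarrow> plane" and A
    by (rule linear_sum)
  have f0: "f 0 = 0" by (simp add: f_def)
  define p where "p = (if v = pD then pU else pC)"
  have s3: "1 < sqrt 3" by simp
  have p: "p \<in> nbrs v" "\<And>u. u \<in> nbrs v \<Longrightarrow> u \<noteq> p \<Longrightarrow> f (sgn (u - v)) < 0"
    using v dx_dy(3) s3 by (auto simp: p_def f_def nbrs_eq directions)
  have sums: "(\<Sum>u\<in>nbrs v. f (sgn (u - v))) = 0" "(\<Sum>u\<in>{u \<in> nbrs v. R u}. f (sgn (u - v))) = 0"
    using sum_neighbours[OF v'] R f0 by (simp_all flip: fsum)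
  have "R u \<longleftrightarrow> R p" if "u \<in> nbrs v" for u
    by (rule single_positive_all_or_none[where f = "\<lambda>u. f (sgn (u - v))",
          OF finite_nbrs[OF v'] p sums that])
  then show ?thesis using u by simp
qed

text \<open>With weights 0 and 1, vertical balance makes the differences \<open>d\<close> between
  opposite weights agree on the two slanted lines. Horizontal balance then equates
  \<open>2 * dx * d\<close> with a number in {-1, 0, 1}, and \<open>d = 0\<close> because
  \<open>dx\<close> is positive and not \<open>1 / 2\<close>. The pair \<open>flip pU\<close>,
  \<open>pD\<close> is covered by the reflected copy.\<close>

lemma nbrs_crossing:
  assumes R: "(\<Sum>u | u \<in> nbrs pC \<and> R u. sgn (u - pC)) = 0"
  shows "R pA \<longleftrightarrow> R pF" "R pU \<longleftrightarrow> R (flip pD)"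
proof -
  define b where "b u = (if R u then 1 else 0 :: real)" for u
  have "(\<Sum>u\<in>nbrs pC. b u *\<^sub>R sgn (u - pC)) =
      (\<Sum>u\<in>nbrs pC. if R u then sgn (u - pC) else 0)"
    by (intro sum.cong) (auto simp: b_def)
  also have "\<dots> = (\<Sum>u | u \<in> nbrs pC \<and> R u. sgn (u - pC))"
    using finite_nbrs[of pC] by (simp add: sum.inter_filter)
  finally have "(\<Sum>u\<in>nbrs pC. b u *\<^sub>R sgn (u - pC)) = 0"
    using R by simp
  then have "b pA *\<^sub>R pt (- 1) 0 + (b pF *\<^sub>R pt 1 0 + (b pU *\<^sub>R pt dx dy +
      (b (flip pU) *\<^sub>R pt dx (- dy) + (b pD *\<^sub>R pt (- dx) dy + b (flip pD) *\<^sub>R pt (- dx) (- dy))))) = 0"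
    using neighbour_points_distinct by (simp add: nbrs_eq directions)
  then have x: "b pF - b pA + dx * (b pU + b (flip pU) - b pD - b (flip pD)) = 0"
    and "dy * (b pU - b (flip pU) + b pD - b (flip pD)) = 0"
    by (simp_all add: plane_eq_iff algebra_simps)
  then have y: "b pU - b (flip pD) = b (flip pU) - b pD"
    using dx_dy by simp
  have "b pU + b (flip pU) - b pD - b (flip pD) = 2 * (b pU - b (flip pD))"
    using y by simp
  with x have "b pF - b pA + dx * (2 * (b pU - b (flip pD))) = 0"
    by simp
  then show "R pA \<longleftrightarrow> R pF" "R pU \<longleftrightarrow> R (flip pD)"
    using dx_dy by (auto simp: b_def split: if_splits)
qed

section \<open>Assembly: the net is geodesic and irreducible\<close>

lemma net_geodesic: "geodesic_net unbalanced balanced net_edges"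
proof -
  have "balanced_at net_edges x \<and> 3 \<le> card (incident_edges net_edges x)" if "x \<in> balanced" for x
  proof -
    from that obtain g v where g: "g \<in> square_group" and v: "v \<in> {pD, pA, pC, pF}" and x: "x = g v"
      unfolding balanced_def by blast
    have n: "{g v, g u} \<in> net_edges" if "u \<in> nbrs v" for u
      using neighbours_image[OF g v] that by blast
    then have "{u. u \<in> nbrs v \<and> {g v, g u} \<in> net_edges} = nbrs v"
      by blast
    then have "balanced_at net_edges x"
      using balanced_at_iff[OF g v subset_refl] sum_neighbours[OF v] by (simp add: x)
    moreover have "3 \<le> card (incident_edges net_edges x)"
    proof -
      have "inj_on (\<lambda>u. {g v, g u}) (nbrs v)"
        by (rule inj_onI) (auto simp: doubleton_eq_iff square_group_eq_iff[OF g])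
      then have "card (nbrs v) = card ((\<lambda>u. {g v, g u}) ` nbrs v)"
        by (simp add: card_image)
      also have "\<dots> \<le> card (incident_edges net_edges x)"
        using n finite_net_edges by (intro card_mono) (auto simp: incident_edges_def x)
      finally show ?thesis
        using card_nbrs[OF v] by simp
    qed
    ultimately show ?thesis by simp
  qed
  moreover have "\<not> e \<subseteq> unbalanced" if "e \<in> net_edges" for e
  proof -
    from that obtain g p q where "g \<in> square_group" "e = {g p, g q}" "p \<in> {pD, pA, pC, pF}"
      by (rule net_edgesE)
    then have "g p \<in> balanced" "g p \<in> e"
      unfolding balanced_def by auto
    then show ?thesis using disjoint_vertices by blast
  qed
  ultimately show ?thesis
    unfolding geodesic_net_def
    using disjoint_vertices net_embedded net_connected by blast
qed

lemma net_no_proper_subnet: "\<not> proper_subnet balanced net_edges E1"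
proof
  assume "proper_subnet balanced net_edges E1"
  then have E1: "E1 \<subseteq> net_edges" "E1 \<noteq> {}" "E1 \<noteq> net_edges"
    and bal: "\<forall>v \<in> balanced \<inter> \<Union>E1. balanced_at E1 v"
    unfolding proper_subnet_def by auto
  have bal_at: "(\<Sum>u | u \<in> nbrs v \<and> {g v, g u} \<in> E1. sgn (u - v)) = 0"
    if g: "g \<in> square_group" and v: "v \<in> {pD, pA, pC, pF}" for g v
  proof (cases "g v \<in> \<Union>E1")
    case True
    then have "balanced_at E1 (g v)"
      using bal g v unfolding balanced_def by blast
    then show ?thesis
      using balanced_at_iff[OF g v E1(1)] by simp
  next
    \<comment> \<open>A vertex untouched by \<open>E1\<close> carries no balance condition, but its
      sum is empty and hence zero.\<close>
    case False
    then have none: "{u. u \<in> nbrs v \<and> {g v, g u} \<in> E1} = {}" by blast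
    show ?thesis unfolding none by simp
  qed
  have same: "{g v, g u} \<in> E1 \<longleftrightarrow> {g v, g w} \<in> E1"
    if "g \<in> square_group" "v \<in> {pD, pA, pF}" "u \<in> nbrs v" "w \<in> nbrs v" for g v u w
  proof (rule nbrs_all_or_none[OF that(2) _ that(3,4)])
    show "(\<Sum>u | u \<in> nbrs v \<and> {g v, g u} \<in> E1. sgn (u - v)) = 0"
      using bal_at[OF that(1)] that(2) by blast
  qed
  \<comment> \<open>The edge AC of copy \<open>g\<close> serves as reference; the other six edges of
    the copy are shown to be selected exactly when it is.\<close>
  define c where "c g \<longleftrightarrow> {g pA, g pC} \<in> E1" for g
  have AD: "{g pD, g pA} \<in> E1 \<longleftrightarrow> c g" if "g \<in> square_group" for g
    using same[OF that, of pA pC pD] by (simp add: nbrs_eq c_def insert_commute)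
  have DU: "{g pD, g pU} \<in> E1 \<longleftrightarrow> c g" and DC: "{g pD, g pC} \<in> E1 \<longleftrightarrow> c g"
    if "g \<in> square_group" for g
    using same[OF that, of pD pA pU] same[OF that, of pD pA pC] AD[OF that] by (simp_all add: nbrs_eq)
  \<comment> \<open>Adjacent copies share an edge in their common wall: AC across the axis, and DU
    across the diagonal in the next step.\<close>
  have c_flip: "c (g \<circ> flip) = c g" for g
    by (simp add: c_def)
  have c_swap: "c (g \<circ> swap) = c g" if "g \<in> square_group" for g
    using DU[OF that] DU[OF comp_swap_in_square_group[OF that]] by simp
  have CF: "{g pF, g pC} \<in> E1 \<longleftrightarrow> c g" and CU: "{g pC, g pU} \<in> E1 \<longleftrightarrow> c g"
    if g: "g \<in> square_group" for g
  proof -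
    have R: "(\<Sum>u | u \<in> nbrs pC \<and> {g pC, g u} \<in> E1. sgn (u - pC)) = 0"
      using bal_at[OF g] by blast
    show "{g pF, g pC} \<in> E1 \<longleftrightarrow> c g"
      using nbrs_crossing(1)[OF R] by (simp add: c_def insert_commute)
    \<comment> \<open>The continuation of UC beyond C ends at \<open>flip pD\<close>, so it is the
      edge DC of the copy reflected in the axis.\<close>
    have "{g pC, g pU} \<in> E1 \<longleftrightarrow> {(g \<circ> flip) pD, (g \<circ> flip) pC} \<in> E1"
      using nbrs_crossing(2)[OF R] by (simp add: insert_commute)
    then show "{g pC, g pU} \<in> E1 \<longleftrightarrow> c g"
      using DC[OF comp_flip_in_square_group[OF g]] c_flip by simp
  qed
  have FU: "{g pF, g pU} \<in> E1 \<longleftrightarrow> c g" if "g \<in> square_group" for g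
    using same[OF that, of pF pC pU] CF[OF that] by (simp add: nbrs_eq)
  have c_id: "c g = c id" if "g \<in> square_group" for g
    using that by (induction rule: square_group_induct) (simp_all only: c_flip c_swap)
  have "g ` e \<in> E1 \<longleftrightarrow> c id" if g: "g \<in> square_group" and e: "e \<in> sector_edges" for g e
  proof -
    have "g ` e \<in> E1 \<longleftrightarrow> c g"
      using e AD[OF g] DU[OF g] DC[OF g] CF[OF g] CU[OF g] FU[OF g]
      unfolding sector_edges_def
      by (elim insertE emptyE) (simp_all add: insert_commute c_def)
    then show ?thesis using c_id[OF g] by simp
  qed
  then have "E1 = {} \<or> E1 = net_edges"
    using E1(1) unfolding net_edges_def by (cases "c id") blast+
  then show False using E1 by blast
qed

theorem mainTheorem1:
  "\<exists>U B E. irreducible_net U B E \<and> card B = 16 \<and> card U = 4"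
proof (intro exI conjI)
  show "irreducible_net unbalanced balanced net_edges"
    unfolding irreducible_net_def using net_geodesic net_no_proper_subnet by blast
qed (rule card_balanced card_unbalanced)+

end
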